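(* For any $t\in U(n)$ one has $\rho\circ\phi_t=\psi_t\circ\rho$, where $\rho:A_u(n)\to C(U(n))$ is the canonical surjection onto $C(U(n))$, the algebra of complex-valued continuous functions on the group $U(n)$ (which is the maximal classical compact subgroup of $A_u(n)$), $\phi_t:A_u(n)\to A_u(n)$ is the automorphism determined by $\phi_t(u)=(t\otimes1)u(t^*\otimes1)$, and $\psi_t$ is the automorphism of $C(U(n))$ induced by the inner automorphism $\beta_t:U(n)\to U(n)$, $s\mapsto tst^*$.
   Context: $A_u(n)$ is the universal $C^*$-algebra generated by $u_{ij}$, $1\le i,j\le n$, such that both $u=((u_{ij}))$ and $\overline u=((u_{ij}^* ))$ are unitary in $M_n(A_u(n))$; it is a compact quantum group with comultiplication $\Phi(u_{ij})=\sum_k u_{ik}\otimes u_{kj}$, and $u$ is its fundamental unitary. By universality, for $t\in U(n)$ (unitary scalar $n\times n$ matrices), $u\mapsto(t\otimes1)u(t^*\otimes1)$, with $u$ viewed in $M_n(\mathbb C)\otimes A_u(n)$ and $\phi_t$ applied entrywise, extends to an automorphism $\phi_t$ of $A_u(n)$. The surjection $\rho$ sends $u_{ij}$ to the $(i,j)$ coordinate function on $U(n)$. The induced automorphism is $\psi_t(f)=f\circ\beta_t$. *)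

theory Defs
  imports "HOL-Analysis.Analysis" "HOL-Algebra.Subrings"
begin

section \<open>Unital C*-algebras\<close>

text \<open>
  A C*-algebra is a record with an explicit carrier set, so that one can quantify over the
  C*-algebras carried by subsets of a given type.
\<close>

record 'a cstar = "'a ring" +
  scale :: "complex \<Rightarrow> 'a \<Rightarrow> 'a"
  star :: "'a \<Rightarrow> 'a"
  cnorm :: "'a \<Rightarrow> real"

text \<open>
  The value 0 off the carrier is irrelevant, but the locale \<^locale>\<open>Metric_space\<close> requires
  symmetry and nonnegativity on the whole type.
\<close>

definition cdist :: "('a, 'm) cstar_scheme \<Rightarrow> 'a \<Rightarrow> 'a \<Rightarrow> real" where
  "cdist A x y = (if x \<in> carrier A \<and> y \<in> carrier A then cnorm A (x \<ominus>\<^bsub>A\<^esub> y) else 0)"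

locale unital_cstar_algebra = ring A for A :: "('a, 'm) cstar_scheme" (structure) +
  assumes scale_closed: "x \<in> carrier A \<Longrightarrow> scale A c x \<in> carrier A"
    and scale_add_right: "\<lbrakk>x \<in> carrier A; y \<in> carrier A\<rbrakk>
        \<Longrightarrow> scale A c (x \<oplus> y) = scale A c x \<oplus> scale A c y"
    and scale_add_left: "x \<in> carrier A \<Longrightarrow> scale A (c + d) x = scale A c x \<oplus> scale A d x"
    and scale_scale: "x \<in> carrier A \<Longrightarrow> scale A c (scale A d x) = scale A (c * d) x"
    and scale_one: "x \<in> carrier A \<Longrightarrow> scale A 1 x = x"
    and scale_mult_left: "\<lbrakk>x \<in> carrier A; y \<in> carrier A\<rbrakk>
        \<Longrightarrow> scale A c x \<otimes> y = scale A c (x \<otimes> y)"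
    and scale_mult_right: "\<lbrakk>x \<in> carrier A; y \<in> carrier A\<rbrakk>
        \<Longrightarrow> x \<otimes> scale A c y = scale A c (x \<otimes> y)"
    and star_closed: "x \<in> carrier A \<Longrightarrow> star A x \<in> carrier A"
    and star_star: "x \<in> carrier A \<Longrightarrow> star A (star A x) = x"
    and star_add: "\<lbrakk>x \<in> carrier A; y \<in> carrier A\<rbrakk> \<Longrightarrow> star A (x \<oplus> y) = star A x \<oplus> star A y"
    and star_scale: "x \<in> carrier A \<Longrightarrow> star A (scale A c x) = scale A (cnj c) (star A x)"
    and star_mult: "\<lbrakk>x \<in> carrier A; y \<in> carrier A\<rbrakk> \<Longrightarrow> star A (x \<otimes> y) = star A y \<otimes> star A x"
    and norm_nonneg: "x \<in> carrier A \<Longrightarrow> 0 \<le> cnorm A x"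
    and norm_eq_zero: "x \<in> carrier A \<Longrightarrow> cnorm A x = 0 \<longleftrightarrow> x = \<zero>"
    and norm_triangle: "\<lbrakk>x \<in> carrier A; y \<in> carrier A\<rbrakk>
        \<Longrightarrow> cnorm A (x \<oplus> y) \<le> cnorm A x + cnorm A y"
    and norm_scale: "x \<in> carrier A \<Longrightarrow> cnorm A (scale A c x) = cmod c * cnorm A x"
    and norm_mult: "\<lbrakk>x \<in> carrier A; y \<in> carrier A\<rbrakk>
        \<Longrightarrow> cnorm A (x \<otimes> y) \<le> cnorm A x * cnorm A y"
    and cstar_identity: "x \<in> carrier A \<Longrightarrow> cnorm A (star A x \<otimes> x) = (cnorm A x)\<^sup>2"
    and complete: "Metric_space.mcomplete (carrier A) (cdist A)"

text \<open>
  Homomorphisms are unital *-homomorphisms, and \<^term>\<open>h \<in> ring_hom A B\<close> includes unitality.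
  They are made extensional (undefined off the carrier), so that equality of homomorphisms is
  equality of functions.
\<close>

definition star_hom :: "('a, 'm) cstar_scheme \<Rightarrow> ('b, 'k) cstar_scheme \<Rightarrow> ('a \<Rightarrow> 'b) set" where
  "star_hom A B = {h. h \<in> extensional (carrier A) \<and> h \<in> ring_hom A B \<and>
     (\<forall>c. \<forall>x\<in>carrier A. h (scale A c x) = scale B c (h x)) \<and>
     (\<forall>x\<in>carrier A. h (star A x) = star B (h x))}"

definition star_auto :: "('a, 'm) cstar_scheme \<Rightarrow> ('a \<Rightarrow> 'a) set" where
  "star_auto A = {h \<in> star_hom A A. bij_betw h (carrier A) (carrier A)}"

definition cstar_subalgebra :: "'a set \<Rightarrow> ('a, 'm) cstar_scheme \<Rightarrow> bool" where
  "cstar_subalgebra S A \<longleftrightarrow> subring S A \<and>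
     (\<forall>c. \<forall>x\<in>S. scale A c x \<in> S) \<and> (\<forall>x\<in>S. star A x \<in> S) \<and>
     closedin (Metric_space.mtopology (carrier A) (cdist A)) S"

definition cstar_generated_by :: "('a, 'm) cstar_scheme \<Rightarrow> 'a set \<Rightarrow> bool" where
  "cstar_generated_by A X \<longleftrightarrow> (\<forall>S. cstar_subalgebra S A \<and> X \<subseteq> S \<longrightarrow> S = carrier A)"


section \<open>Matrices over a C*-algebra\<close>

text \<open>
  An element of $M_n(A) = M_n(C) \otimes A$ is a function \<open>'n \<Rightarrow> 'n \<Rightarrow> 'a\<close> with values
  in \<^term>\<open>carrier A\<close>, where \<open>n = CARD('n)\<close>.
\<close>

definition mat_mult ::
  "('a, 'm) cstar_scheme \<Rightarrow> ('n::finite \<Rightarrow> 'n \<Rightarrow> 'a) \<Rightarrow> ('n \<Rightarrow> 'n \<Rightarrow> 'a) \<Rightarrow> 'n \<Rightarrow> 'n \<Rightarrow> 'a" where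
  "mat_mult A x y = (\<lambda>i j. finsum A (\<lambda>k. x i k \<otimes>\<^bsub>A\<^esub> y k j) UNIV)"

definition mat_one :: "('a, 'm) cstar_scheme \<Rightarrow> 'n::finite \<Rightarrow> 'n \<Rightarrow> 'a" where
  "mat_one A = (\<lambda>i j. if i = j then \<one>\<^bsub>A\<^esub> else \<zero>\<^bsub>A\<^esub>)"

definition mat_star ::
  "('a, 'm) cstar_scheme \<Rightarrow> ('n::finite \<Rightarrow> 'n \<Rightarrow> 'a) \<Rightarrow> 'n \<Rightarrow> 'n \<Rightarrow> 'a" where
  "mat_star A x = (\<lambda>i j. star A (x j i))"

definition mat_conj ::
  "('a, 'm) cstar_scheme \<Rightarrow> ('n::finite \<Rightarrow> 'n \<Rightarrow> 'a) \<Rightarrow> 'n \<Rightarrow> 'n \<Rightarrow> 'a" where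
  "mat_conj A x = (\<lambda>i j. star A (x i j))"

definition mat_unitary :: "('a, 'm) cstar_scheme \<Rightarrow> ('n::finite \<Rightarrow> 'n \<Rightarrow> 'a) \<Rightarrow> bool" where
  "mat_unitary A x \<longleftrightarrow> (\<forall>i j. x i j \<in> carrier A) \<and>
     mat_mult A (mat_star A x) x = mat_one A \<and> mat_mult A x (mat_star A x) = mat_one A"

text \<open>The scalar matrix $t \otimes 1$.\<close>

definition mat_scalar ::
  "('a, 'm) cstar_scheme \<Rightarrow> complex ^ 'n ^ 'n \<Rightarrow> 'n::finite \<Rightarrow> 'n \<Rightarrow> 'a" where
  "mat_scalar A t = (\<lambda>i j. scale A (t $ i $ j) \<one>\<^bsub>A\<^esub>)"


section \<open>The unitary group and its algebra of continuous functions\<close>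

definition adjoint_mat :: "complex ^ 'n ^ 'n \<Rightarrow> complex ^ 'n ^ 'n" where
  "adjoint_mat s = (\<chi> i j. cnj (s $ j $ i))"

definition unitary_group :: "(complex ^ 'n ^ 'n) set" where
  "unitary_group = {s. adjoint_mat s ** s = mat 1 \<and> s ** adjoint_mat s = mat 1}"

definition inner_aut :: "complex ^ 'n ^ 'n \<Rightarrow> complex ^ 'n ^ 'n \<Rightarrow> complex ^ 'n ^ 'n" where
  "inner_aut t s = t ** s ** adjoint_mat t"

text \<open>
  Functions on the unitary group are extensional functions on the ambient matrix type, and
  the norm is the supremum norm.
\<close>

definition CU :: "(complex ^ 'n ^ 'n \<Rightarrow> complex) cstar" where
  "CU = \<lparr> carrier = {f \<in> extensional unitary_group. continuous_on unitary_group f},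
     mult = (\<lambda>f g. \<lambda>s\<in>unitary_group. f s * g s),
     one = (\<lambda>s\<in>unitary_group. 1),
     zero = (\<lambda>s\<in>unitary_group. 0),
     add = (\<lambda>f g. \<lambda>s\<in>unitary_group. f s + g s),
     scale = (\<lambda>c f. \<lambda>s\<in>unitary_group. c * f s),
     star = (\<lambda>f. \<lambda>s\<in>unitary_group. cnj (f s)),
     cnorm = (\<lambda>f. SUP s\<in>unitary_group. cmod (f s)) \<rparr>"

definition coord_fun :: "'n \<Rightarrow> 'n \<Rightarrow> complex ^ 'n ^ 'n \<Rightarrow> complex" where
  "coord_fun i j = (\<lambda>s\<in>unitary_group. s $ i $ j)"

definition psi ::
  "complex ^ 'n ^ 'n \<Rightarrow> (complex ^ 'n ^ 'n \<Rightarrow> complex) \<Rightarrow> (complex ^ 'n ^ 'n \<Rightarrow> complex)" where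
  "psi t = (\<lambda>f\<in>carrier CU. \<lambda>s\<in>unitary_group. f (inner_aut t s))"


section \<open>The universal C*-algebra $A_u(n)$\<close>

definition biunitary :: "('a, 'm) cstar_scheme \<Rightarrow> ('n::finite \<Rightarrow> 'n \<Rightarrow> 'a) \<Rightarrow> bool" where
  "biunitary A u \<longleftrightarrow> mat_unitary A u \<and> mat_unitary A (mat_conj A u)"

text \<open>
  The universal property of \<open>(A, u)\<close> against all unital C*-algebras whose carrier is a subset
  of the type \<open>'b\<close>.
\<close>

definition universal_for ::
  "'b itself \<Rightarrow> 'a cstar \<Rightarrow> ('n::finite \<Rightarrow> 'n \<Rightarrow> 'a) \<Rightarrow> bool" where
  "universal_for T A u \<longleftrightarrow> (\<forall>(B :: 'b cstar) v. unital_cstar_algebra B \<and> biunitary B v \<longrightarrow>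
     (\<exists>!h. h \<in> star_hom A B \<and> (\<forall>i j. h (u i j) = v i j)))"

text \<open>
  HOL cannot quantify over types inside a formula, so the universal property is stated for the
  carrier type of \<open>A\<close> itself and for the type on which the algebra \<^term>\<open>CU\<close> of continuous
  functions on the unitary group lives. This loses nothing. In any unital C*-algebra,
  the entries of a biunitary matrix generate a separable C*-subalgebra, which has at most
  continuum many elements and is therefore isomorphic to one carried by a subset of
  \<^typ>\<open>complex ^ 'n ^ 'n \<Rightarrow> complex\<close>.
\<close>

definition is_Au :: "'a cstar \<Rightarrow> ('n::finite \<Rightarrow> 'n \<Rightarrow> 'a) \<Rightarrow> bool" where
  "is_Au A u \<longleftrightarrow> unital_cstar_algebra A \<and> biunitary A u \<and>
     cstar_generated_by A {u i j | i j. True} \<and>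
     universal_for TYPE('a) A u \<and>
     universal_for TYPE(complex ^ 'n ^ 'n \<Rightarrow> complex) A u"

definition phi ::
  "'a cstar \<Rightarrow> ('n::finite \<Rightarrow> 'n \<Rightarrow> 'a) \<Rightarrow> complex ^ 'n ^ 'n \<Rightarrow> 'a \<Rightarrow> 'a" where
  "phi A u t = (THE \<phi>. \<phi> \<in> star_auto A \<and>
     (\<lambda>i j. \<phi> (u i j)) =
       mat_mult A (mat_mult A (mat_scalar A t) u) (mat_scalar A (adjoint_mat t)))"

definition rho ::
  "'a cstar \<Rightarrow> ('n::finite \<Rightarrow> 'n \<Rightarrow> 'a) \<Rightarrow> 'a \<Rightarrow> complex ^ 'n ^ 'n \<Rightarrow> complex" where
  "rho A u = (THE \<rho>. \<rho> \<in> star_hom A CU \<and> (\<forall>i j. \<rho> (u i j) = coord_fun i j))"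

end

theory Submission
  imports Defs
begin

text \<open>
  Both sides are unital *-homomorphisms from $A_u(n)$ to $C(U(n))$ which send the fundamental
  unitary to the biunitary matrix \<open>(t \<otimes> 1) c (t\<^sup>* \<otimes> 1)\<close>, where \<open>c\<close> is the matrix of
  coordinate functions, so they agree by universality. What has to be checked is that
  $C(U(n))$ is a unital C*-algebra in which \<open>c\<close> is biunitary (so that \<open>\<rho>\<close> exists), that
  conjugation by scalar unitaries preserves biunitarity, and that $\phi_t$ is an automorphism,
  its inverse being the homomorphism induced by \<open>t\<^sup>*\<close>.
\<close>

section \<open>Finite sums in abelian monoids and under additive maps\<close>

lemma (in abelian_group_hom) hom_finsum_additive:
  assumes "finite S" "f \<in> S \<rightarrow> carrier G"
  shows "h (finsum G f S) = finsum H (\<lambda>x. h (f x)) S"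
  using assms
proof (induction S rule: finite_induct)
  case (insert x S)
  then have "(\<lambda>y. h (f y)) \<in> S \<rightarrow> carrier H" "h (f x) \<in> carrier H" "f \<in> S \<rightarrow> carrier G" "f x \<in> carrier G"
    by (auto intro: hom_closed)
  with insert show ?case by (simp add: G.finsum_insert H.finsum_insert G.finsum_closed)
qed simp

text \<open>This interchange of summations is what makes the matrix product associative.\<close>

lemma (in abelian_monoid) finsum_swap:
  assumes "finite S" "finite T" "\<And>i j. \<lbrakk>i \<in> S; j \<in> T\<rbrakk> \<Longrightarrow> f i j \<in> carrier G"
  shows "(\<Oplus>i\<in>S. \<Oplus>j\<in>T. f i j) = (\<Oplus>j\<in>T. \<Oplus>i\<in>S. f i j)"
  using assms(1,3)
proof (induction S rule: finite_induct)
  case empty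
  show ?case by (simp add: finsum_zero assms(2))
next
  case (insert x S)
  have "(\<Oplus>j\<in>T. \<Oplus>i\<in>insert x S. f i j) = (\<Oplus>j\<in>T. f x j \<oplus> (\<Oplus>i\<in>S. f i j))"
    using insert by (intro finsum_cong') (auto intro!: finsum_insert finsum_closed)
  also have "\<dots> = (\<Oplus>j\<in>T. f x j) \<oplus> (\<Oplus>j\<in>T. \<Oplus>i\<in>S. f i j)"
    using insert by (intro finsum_addf) (auto intro!: finsum_closed)
  also have "\<dots> = (\<Oplus>i\<in>insert x S. \<Oplus>j\<in>T. f i j)"
    using insert by (subst finsum_insert) (auto intro!: finsum_closed)
  finally show ?case by simp
qed

section \<open>Scalar unitary matrices\<close>

text \<open>Needed for the second half of biunitarity: conjugating entrywise turns conjugation by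
  \<open>t\<close> into conjugation by \<open>conj_mat t\<close>.\<close>

definition conj_mat :: "complex ^ 'n ^ 'n \<Rightarrow> complex ^ 'n ^ 'n" where
  "conj_mat s = (\<chi> i j. cnj (s $ i $ j))"

lemma adjoint_mat_adjoint_mat [simp]: "adjoint_mat (adjoint_mat s) = s"
  by (simp add: adjoint_mat_def vec_eq_iff)

lemma adjoint_mat_one [simp]: "adjoint_mat (mat 1 :: complex ^ 'n ^ 'n) = mat 1"
  by (auto simp: adjoint_mat_def mat_def vec_eq_iff)

lemma adjoint_mat_mult:
  fixes s t :: "complex ^ 'n::finite ^ 'n"
  shows "adjoint_mat (s ** t) = adjoint_mat t ** adjoint_mat s"
  by (simp add: adjoint_mat_def vec_eq_iff matrix_matrix_mult_def mult.commute)

lemma conj_mat_mult: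
  fixes s t :: "complex ^ 'n::finite ^ 'n"
  shows "conj_mat (s ** t) = conj_mat s ** conj_mat t"
  by (simp add: conj_mat_def vec_eq_iff matrix_matrix_mult_def)

lemma conj_mat_one [simp]: "conj_mat (mat 1 :: complex ^ 'n ^ 'n) = mat 1"
  by (auto simp: conj_mat_def mat_def vec_eq_iff)

lemma conj_mat_adjoint_mat: "conj_mat (adjoint_mat s) = adjoint_mat (conj_mat s)"
  by (simp add: conj_mat_def adjoint_mat_def vec_eq_iff)

lemma adjoint_mat_unitary: "s \<in> unitary_group \<Longrightarrow> adjoint_mat s \<in> unitary_group"
  by (simp add: unitary_group_def)

lemma one_unitary: "(mat 1 :: complex ^ 'n::finite ^ 'n) \<in> unitary_group"
  by (simp add: unitary_group_def)

lemma mult_unitary: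
  fixes s t :: "complex ^ 'n::finite ^ 'n"
  assumes s: "s \<in> unitary_group" and t: "t \<in> unitary_group"
  shows "s ** t \<in> unitary_group"
proof -
  have "adjoint_mat t ** adjoint_mat s ** (s ** t)
      = adjoint_mat t ** (adjoint_mat s ** s) ** t"
    and "s ** t ** (adjoint_mat t ** adjoint_mat s)
      = s ** (t ** adjoint_mat t) ** adjoint_mat s"
    by (simp_all add: matrix_mul_assoc)
  with s t show ?thesis by (simp add: unitary_group_def adjoint_mat_mult)
qed

lemma inner_aut_unitary:
  fixes s t :: "complex ^ 'n::finite ^ 'n"
  shows "\<lbrakk>s \<in> unitary_group; t \<in> unitary_group\<rbrakk> \<Longrightarrow> inner_aut t s \<in> unitary_group"
  unfolding inner_aut_def by (intro mult_unitary adjoint_mat_unitary)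

text \<open>Entrywise conjugation of scalar matrices is multiplicative, unital and commutes with the
  adjoint, so it preserves both unitarity equations.\<close>

lemma conj_mat_unitary:
  fixes s :: "complex ^ 'n::finite ^ 'n"
  assumes "s \<in> unitary_group"
  shows "conj_mat s \<in> unitary_group"
  using assms arg_cong[of _ _ conj_mat] conj_mat_one
  unfolding unitary_group_def mem_Collect_eq conj_mat_adjoint_mat[symmetric] conj_mat_mult[symmetric]
  by metis

section \<open>Conjugating matrices over a C*-algebra by scalar unitaries\<close>

context unital_cstar_algebra
begin

text \<open>The involution reverses products and is conjugate-linear, so it is viewed as a
  homomorphism of additive groups; this is enough to move it through finite sums.\<close>

lemma star_abelian_hom: "abelian_group_hom A A (star A)"
  by (intro abelian_group_homI abelian_group_axioms group_hom.intro group_hom_axioms.intro a_group)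
     (auto simp: hom_def star_closed star_add)

lemma zero_scale:
  assumes "x \<in> carrier A"
  shows "scale A 0 x = \<zero>"
proof -
  have "scale A 0 x \<oplus> scale A 0 x = scale A 0 x"
    using scale_add_left[OF assms, of 0 0] by simp
  then show ?thesis
    using assms scale_closed by (metis add.l_cancel_one')
qed

lemma star_one [simp]: "star A \<one> = \<one>"
  by (metis l_one one_closed r_one star_closed star_mult star_star)

lemma star_finsum:
  "\<lbrakk>finite S; f \<in> S \<rightarrow> carrier A\<rbrakk> \<Longrightarrow> star A (finsum A f S) = (\<Oplus>k\<in>S. star A (f k))"
  by (rule abelian_group_hom.hom_finsum_additive[OF star_abelian_hom])

lemma sum_scale:
  assumes "finite S" "x \<in> carrier A"
  shows "scale A (sum c S) x = (\<Oplus>k\<in>S. scale A (c k) x)"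
  using assms(1)
proof (induction S rule: finite_induct)
  case empty
  show ?case by (simp add: zero_scale assms(2))
next
  case (insert k S)
  then show ?case
    by (subst finsum_insert) (simp_all add: scale_add_left scale_closed assms(2) Pi_def)
qed

abbreviation "mats \<equiv> {x. \<forall>i j. x i j \<in> carrier A}"

lemma mat_mult_closed: "\<lbrakk>x \<in> mats; y \<in> mats\<rbrakk> \<Longrightarrow> mat_mult A x y \<in> mats"
  by (auto simp: mat_mult_def intro!: finsum_closed)

lemma mat_star_closed: "x \<in> mats \<Longrightarrow> mat_star A x \<in> mats"
  by (auto simp: mat_star_def star_closed)

lemma mat_conj_closed: "x \<in> mats \<Longrightarrow> mat_conj A x \<in> mats"
  by (auto simp: mat_conj_def star_closed)

lemma mat_scalar_closed: "mat_scalar A t \<in> mats"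
  by (auto simp: mat_scalar_def scale_closed)

lemmas mats_closed = mat_mult_closed mat_star_closed mat_conj_closed mat_scalar_closed

lemma mat_mult_assoc:
  assumes "x \<in> mats" "y \<in> mats" "z \<in> mats"
  shows "mat_mult A (mat_mult A x y) z = mat_mult A x (mat_mult A y z)"
proof (intro ext)
  fix i j
  note c [simp] = assms[unfolded mem_Collect_eq, rule_format]
  have "(\<Oplus>k\<in>UNIV. (\<Oplus>l\<in>UNIV. x i l \<otimes> y l k) \<otimes> z k j) = (\<Oplus>k\<in>UNIV. \<Oplus>l\<in>UNIV. x i l \<otimes> (y l k \<otimes> z k j))"
    by (intro finsum_cong') (auto simp: finsum_ldistr m_assoc intro!: finsum_closed)
  also have "\<dots> = (\<Oplus>l\<in>UNIV. \<Oplus>k\<in>UNIV. x i l \<otimes> (y l k \<otimes> z k j))"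
    by (intro finsum_swap) auto
  also have "\<dots> = (\<Oplus>l\<in>UNIV. x i l \<otimes> (\<Oplus>k\<in>UNIV. y l k \<otimes> z k j))"
    by (intro finsum_cong') (auto simp: finsum_rdistr intro!: finsum_closed)
  finally show "mat_mult A (mat_mult A x y) z i j = mat_mult A x (mat_mult A y z) i j"
    by (simp add: mat_mult_def)
qed

lemma mat_mult_one_left: "x \<in> mats \<Longrightarrow> mat_mult A (mat_one A) x = x"
proof (intro ext)
  fix i j assume x: "x \<in> mats"
  have "(\<Oplus>k\<in>UNIV. mat_one A i k \<otimes> x k j) = (\<Oplus>k\<in>UNIV. if i = k then x k j else \<zero>)"
    using x by (intro finsum_cong') (auto simp: mat_one_def)
  also have "\<dots> = x i j"
    using x by (intro add.finprod_singleton) auto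
  finally show "mat_mult A (mat_one A) x i j = x i j"
    by (simp add: mat_mult_def)
qed

lemma mat_mult_one_right: "x \<in> mats \<Longrightarrow> mat_mult A x (mat_one A) = x"
proof (intro ext)
  fix i j assume x: "x \<in> mats"
  have "(\<Oplus>k\<in>UNIV. x i k \<otimes> mat_one A k j) = (\<Oplus>k\<in>UNIV. if j = k then x i k else \<zero>)"
    using x by (intro finsum_cong') (auto simp: mat_one_def)
  also have "\<dots> = x i j"
    using x by (intro add.finprod_singleton) auto
  finally show "mat_mult A x (mat_one A) i j = x i j"
    by (simp add: mat_mult_def)
qed

lemma mat_star_mult:
  assumes "x \<in> mats" "y \<in> mats"
  shows "mat_star A (mat_mult A x y) = mat_mult A (mat_star A y) (mat_star A x)"
  using assms
  by (intro ext)
     (auto simp: mat_star_def mat_mult_def star_finsum star_mult star_closed intro!: finsum_cong')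

lemma mat_star_scalar: "mat_star A (mat_scalar A t) = mat_scalar A (adjoint_mat t)"
  by (simp add: fun_eq_iff mat_star_def mat_scalar_def adjoint_mat_def star_scale)

lemma mat_scalar_one: "mat_scalar A (mat 1) = mat_one A"
  by (auto simp: fun_eq_iff mat_one_def mat_scalar_def mat_def scale_one zero_scale)

lemma mat_scalar_mult: "mat_mult A (mat_scalar A s) (mat_scalar A t) = mat_scalar A (s ** t)"
  by (intro ext)
     (auto simp: mat_scalar_def mat_mult_def matrix_matrix_mult_def sum_scale scale_mult_left
        scale_scale scale_closed intro!: finsum_cong')

text \<open>For \<open>x = u\<close> this is the right-hand side of the equation characterising
  \<open>phi A u t\<close>. Being available in every unital C*-algebra, it serves both for
  \<open>A\<close> and for \<open>CU\<close>.\<close>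

definition conjugate_by :: "complex ^ 'n ^ 'n \<Rightarrow> ('n::finite \<Rightarrow> 'n \<Rightarrow> 'a) \<Rightarrow> 'n \<Rightarrow> 'n \<Rightarrow> 'a" where
  "conjugate_by t x = mat_mult A (mat_mult A (mat_scalar A t) x) (mat_scalar A (adjoint_mat t))"

lemma conjugate_by_closed: "x \<in> mats \<Longrightarrow> conjugate_by t x \<in> mats"
  unfolding conjugate_by_def by (intro mats_closed)

text \<open>The two inner scalar factors multiply to the identity because \<open>t\<close> is
  unitary.\<close>

lemma conjugate_by_mult:
  assumes t: "t \<in> unitary_group" and x: "x \<in> mats" and y: "y \<in> mats"
  shows "mat_mult A (conjugate_by t x) (conjugate_by t y) = conjugate_by t (mat_mult A x y)"
proof -
  let ?t = "mat_scalar A t" and ?t' = "mat_scalar A (adjoint_mat t)"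
  note c = x y mats_closed
  have "mat_mult A (conjugate_by t x) (conjugate_by t y)
      = mat_mult A ?t (mat_mult A x (mat_mult A (mat_mult A ?t' ?t) (mat_mult A y ?t')))"
    by (simp only: conjugate_by_def mat_mult_assoc c)
  also have "mat_mult A ?t' ?t = mat_one A"
    using t by (simp add: mat_scalar_mult mat_scalar_one unitary_group_def)
  also have "mat_mult A ?t (mat_mult A x (mat_mult A (mat_one A) (mat_mult A y ?t')))
      = conjugate_by t (mat_mult A x y)"
    by (simp only: conjugate_by_def mat_mult_assoc c mat_mult_one_left)
  finally show ?thesis .
qed

lemma conjugate_by_one:
  "t \<in> unitary_group \<Longrightarrow> conjugate_by t (mat_one A) = mat_one A"
  by (simp add: conjugate_by_def mat_mult_one_right[OF mat_scalar_closed] mat_scalar_mult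
      mat_scalar_one unitary_group_def)

text \<open>The scalar factors on each side collapse to the identity; this will make the
  homomorphisms induced by \<open>t\<close> and \<open>adjoint_mat t\<close> mutually
  inverse.\<close>

lemma conjugate_by_adjoint:
  assumes t: "t \<in> unitary_group" and x: "x \<in> mats"
  shows "conjugate_by t (conjugate_by (adjoint_mat t) x) = x"
proof -
  let ?t = "mat_scalar A t" and ?t' = "mat_scalar A (adjoint_mat t)"
  have "conjugate_by t (conjugate_by (adjoint_mat t) x)
      = mat_mult A (mat_mult A ?t ?t') (mat_mult A x (mat_mult A ?t ?t'))"
    by (simp only: conjugate_by_def mat_mult_assoc x mats_closed adjoint_mat_adjoint_mat)
  also have "mat_mult A ?t ?t' = mat_one A"
    using t by (simp add: mat_scalar_mult mat_scalar_one unitary_group_def)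
  finally show ?thesis
    using x by (simp only: mat_mult_one_left mat_mult_one_right)
qed

text \<open>The star reverses the three factors and also exchanges the two outer ones, so they end
  up where they were.\<close>

lemma mat_star_conjugate_by:
  "x \<in> mats \<Longrightarrow> mat_star A (conjugate_by t x) = conjugate_by t (mat_star A x)"
  by (simp only: conjugate_by_def mat_star_mult mat_star_scalar mat_mult_assoc mats_closed
      adjoint_mat_adjoint_mat)

text \<open>Conjugation by a unitary \<open>t\<close> is multiplicative, unital and commutes with
  \<open>mat_star\<close>, so it carries the two unitarity equations over.\<close>

lemma mat_unitary_conjugate_by:
  assumes t: "t \<in> unitary_group" and x: "mat_unitary A x"
  shows "mat_unitary A (conjugate_by t x)"
proof -
  have c: "x \<in> mats" "mat_star A x \<in> mats"
    using x by (auto simp: mat_unitary_def mat_star_def star_closed)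
  then show ?thesis
    using x conjugate_by_closed[OF c(1)] unfolding mat_unitary_def
    by (simp only: mat_star_conjugate_by conjugate_by_mult[OF t] conjugate_by_one[OF t]) simp
qed

text \<open>Entrywise conjugation reverses products, except that scalar entries commute with
  everything.\<close>

lemma mat_conj_scalar_mult:
  assumes x: "x \<in> mats"
  shows "mat_conj A (mat_mult A (mat_scalar A t) x) = mat_mult A (mat_scalar A (conj_mat t)) (mat_conj A x)"
    and "mat_conj A (mat_mult A x (mat_scalar A t)) = mat_mult A (mat_conj A x) (mat_scalar A (conj_mat t))"
  using x by (intro ext;
     auto simp: mat_conj_def mat_mult_def mat_scalar_def conj_mat_def star_finsum star_scale
       scale_mult_left scale_mult_right scale_closed star_closed intro!: finsum_cong')+

lemma mat_conj_conjugate_by: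
  assumes x: "x \<in> mats"
  shows "mat_conj A (conjugate_by t x) = conjugate_by (conj_mat t) (mat_conj A x)"
  by (simp only: conjugate_by_def mat_conj_scalar_mult x mats_closed conj_mat_adjoint_mat)

text \<open>The condition on \<open>mat_conj A x\<close> reduces to the one on \<open>x\<close>,
  with the unitary \<open>conj_mat t\<close> in place of \<open>t\<close>.\<close>

lemma biunitary_conjugate_by:
  assumes t: "t \<in> unitary_group" and x: "biunitary A x"
  shows "biunitary A (conjugate_by t x)"
proof -
  have "x \<in> mats" using x by (auto simp: biunitary_def mat_unitary_def)
  then show ?thesis
    using x t by (auto simp: biunitary_def mat_conj_conjugate_by conj_mat_unitary
      intro!: mat_unitary_conjugate_by)
qed

end

section \<open>Unital *-homomorphisms\<close>

lemma star_hom_ring_hom: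
  assumes "h \<in> star_hom A B" "unital_cstar_algebra A" "unital_cstar_algebra B"
  shows "ring_hom_ring A B h"
  using assms by (auto simp: star_hom_def unital_cstar_algebra_def intro: ring_hom_ringI2)

lemma star_hom_mat_mult:
  assumes h: "h \<in> star_hom A B" and A: "unital_cstar_algebra A" and B: "unital_cstar_algebra B"
    and x: "\<And>i j. x i j \<in> carrier A" and y: "\<And>i j. y i j \<in> carrier A"
  shows "h (mat_mult A x y i j) = mat_mult B (\<lambda>i j. h (x i j)) (\<lambda>i j. h (y i j)) i j"
proof -
  interpret ring_hom_ring A B h by (rule star_hom_ring_hom[OF h A B])
  have "h (mat_mult A x y i j) = finsum B (\<lambda>k. h (x i k \<otimes>\<^bsub>A\<^esub> y k j)) UNIV"
    unfolding mat_mult_def using x y by (intro hom_finsum_additive) auto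
  then show ?thesis using x y by (simp add: mat_mult_def)
qed

text \<open>A unital linear map sends the scalar matrix of \<open>t\<close> over \<open>A\<close> to
  the one over \<open>B\<close>, so only the middle factor changes.\<close>

lemma star_hom_conjugate_by:
  fixes x :: "'n::finite \<Rightarrow> 'n \<Rightarrow> 'a" and A :: "('a, 'm) cstar_scheme"
  assumes h: "h \<in> star_hom A B" and A: "unital_cstar_algebra A" and B: "unital_cstar_algebra B"
    and x: "\<And>i j. x i j \<in> carrier A"
  shows "h (unital_cstar_algebra.conjugate_by A t x i j)
    = unital_cstar_algebra.conjugate_by B t (\<lambda>i j. h (x i j)) i j"
proof -
  interpret A: unital_cstar_algebra A by fact
  interpret B: unital_cstar_algebra B by fact
  interpret ring_hom_ring A B h by (rule star_hom_ring_hom[OF h A B])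
  have s: "(\<lambda>i j. h (mat_scalar A t i j)) = mat_scalar B t" for t :: "complex ^ 'n ^ 'n"
    using h by (simp add: mat_scalar_def star_hom_def)
  have c: "mat_scalar A t i j \<in> carrier A" "mat_mult A (mat_scalar A t) x i j \<in> carrier A"
    for t :: "complex ^ 'n ^ 'n" and i j
    using x A.mat_mult_closed[of "mat_scalar A t" x] A.mat_scalar_closed[of t] by auto
  show ?thesis
    unfolding A.conjugate_by_def B.conjugate_by_def
    by (simp add: star_hom_mat_mult[OF h A B] c x s)
qed

text \<open>The composite is restricted to \<open>carrier A\<close> because members of
  \<open>star_hom\<close> are extensional.\<close>

lemma star_hom_compose:
  assumes h: "h \<in> star_hom A B" and g: "g \<in> star_hom B C" and A: "unital_cstar_algebra A"
  shows "compose (carrier A) g h \<in> star_hom A C"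
proof -
  interpret A: unital_cstar_algebra A by fact
  show ?thesis
    using h g unfolding star_hom_def ring_hom_def compose_def
    by (simp add: Pi_iff A.scale_closed A.star_closed)
qed

section \<open>Continuous functions on the unitary group\<close>

lemma CU_simps:
  "carrier CU = {f \<in> extensional unitary_group. continuous_on unitary_group f}"
  "f \<otimes>\<^bsub>CU\<^esub> g = (\<lambda>s\<in>unitary_group. f s * g s)"
  "\<one>\<^bsub>CU\<^esub> = (\<lambda>s\<in>unitary_group. 1)"
  "\<zero>\<^bsub>CU\<^esub> = (\<lambda>s\<in>unitary_group. 0)"
  "f \<oplus>\<^bsub>CU\<^esub> g = (\<lambda>s\<in>unitary_group. f s + g s)"
  "scale CU c f = (\<lambda>s\<in>unitary_group. c * f s)"
  "star CU f = (\<lambda>s\<in>unitary_group. cnj (f s))"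
  by (simp_all add: CU_def)

lemma CU_cnorm: "cnorm CU f = (SUP s\<in>unitary_group. cmod (f s))"
  by (simp add: CU_def)

lemma continuous_on_restrict_iff [simp]:
  "continuous_on S (restrict f S) \<longleftrightarrow> continuous_on S f"
  by (rule continuous_on_cong) auto

lemma CU_eqI:
  "\<lbrakk>f \<in> carrier CU; g \<in> carrier CU; \<And>s. s \<in> unitary_group \<Longrightarrow> f s = g s\<rbrakk> \<Longrightarrow> f = g"
  by (auto simp: CU_simps intro: extensionalityI)

section \<open>Compactness of the unitary group and the supremum norm\<close>

lemma cmod_unitary_entry_le:
  fixes s :: "complex ^ 'n::finite ^ 'n"
  assumes "s \<in> unitary_group"
  shows "cmod (s $ i $ j) \<le> 1"
proof -
  \<comment> \<open>This diagonal entry is the squared length of row \<open>i\<close>, which bounds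
    the squared modulus of each entry of that row.\<close>
  have "(s ** adjoint_mat s) $ i $ i = 1"
    using assms by (simp add: unitary_group_def mat_def)
  then have "(\<Sum>k\<in>UNIV. complex_of_real ((cmod (s $ i $ k))\<^sup>2)) = 1"
    by (simp add: matrix_matrix_mult_def adjoint_mat_def complex_norm_square del: of_real_power)
  then have "complex_of_real (\<Sum>k\<in>UNIV. (cmod (s $ i $ k))\<^sup>2) = complex_of_real 1"
    by (simp only: of_real_sum) simp
  then have "(\<Sum>k\<in>UNIV. (cmod (s $ i $ k))\<^sup>2) = 1"
    by (simp only: of_real_eq_iff)
  moreover have "(cmod (s $ i $ j))\<^sup>2 \<le> (\<Sum>k\<in>UNIV. (cmod (s $ i $ k))\<^sup>2)"
    by (intro member_le_sum) auto
  ultimately show ?thesis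
    by (metis abs_norm_cancel abs_square_le_1)
qed

lemma bounded_unitary_group: "bounded (unitary_group :: (complex ^ 'n::finite ^ 'n) set)"
proof (rule boundedI)
  fix s :: "complex ^ 'n ^ 'n" assume s: "s \<in> unitary_group"
  \<comment> \<open>The Euclidean norm is at most the sum of the moduli of all entries, which gives
    the bound \<open>CARD('n)\<close> squared.\<close>
  have "norm s \<le> (\<Sum>i\<in>UNIV. norm (s $ i))"
    by (simp add: norm_vec_def L2_set_le_sum)
  also have "\<dots> \<le> (\<Sum>i\<in>(UNIV :: 'n set). \<Sum>j\<in>(UNIV :: 'n set). 1)"
  proof (rule sum_mono)
    fix i
    have "norm (s $ i) \<le> (\<Sum>j\<in>UNIV. norm (s $ i $ j))"
      by (simp add: norm_vec_def L2_set_le_sum)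
    also have "\<dots> \<le> (\<Sum>j\<in>(UNIV :: 'n set). 1)"
      by (intro sum_mono cmod_unitary_entry_le s)
    finally show "norm (s $ i) \<le> (\<Sum>j\<in>(UNIV :: 'n set). 1)" .
  qed
  finally show "norm s \<le> (\<Sum>i\<in>(UNIV :: 'n set). \<Sum>j\<in>(UNIV :: 'n set). 1)" .
qed

lemma continuous_on_matrix_mult [continuous_intros]:
  fixes f g :: "'b::topological_space \<Rightarrow> complex ^ 'n::finite ^ 'n"
  assumes "continuous_on S f" "continuous_on S g"
  shows "continuous_on S (\<lambda>x. f x ** g x)"
  unfolding matrix_matrix_mult_def using assms by (intro continuous_intros)

lemma continuous_on_adjoint_mat [continuous_intros]:
  fixes f :: "'b::topological_space \<Rightarrow> complex ^ 'n::finite ^ 'n"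
  assumes "continuous_on S f"
  shows "continuous_on S (\<lambda>x. adjoint_mat (f x))"
  unfolding adjoint_mat_def using assms by (intro continuous_intros)

lemma closed_unitary_group: "closed (unitary_group :: (complex ^ 'n::finite ^ 'n) set)"
  unfolding unitary_group_def
  by (intro closed_Collect_conj closed_Collect_eq continuous_intros)

lemma compact_unitary_group: "compact (unitary_group :: (complex ^ 'n::finite ^ 'n) set)"
  using bounded_unitary_group closed_unitary_group compact_eq_bounded_closed by blast

text \<open>By compactness the supremum is a maximum; the identity matrix shows that the group is
  nonempty. Norm laws thereby become statements about values at points.\<close>

lemma CU_cnorm_attained:
  fixes f :: "complex ^ 'n::finite ^ 'n \<Rightarrow> complex"
  assumes "f \<in> carrier CU"
  obtains s where "s \<in> unitary_group" "cnorm CU f = cmod (f s)"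
    "\<And>s'. s' \<in> unitary_group \<Longrightarrow> cmod (f s') \<le> cmod (f s)"
proof -
  have "continuous_on unitary_group (\<lambda>s. cmod (f s))"
    using assms by (auto simp: CU_simps intro: continuous_intros)
  then obtain s where s: "s \<in> unitary_group" "\<forall>s'\<in>unitary_group. cmod (f s') \<le> cmod (f s)"
    using continuous_attains_sup[OF compact_unitary_group] one_unitary by blast
  then have "cnorm CU f = cmod (f s)"
    unfolding CU_cnorm by (intro cSup_eq_maximum) auto
  with s that show thesis by blast
qed

lemma cmod_le_CU_cnorm:
  fixes f :: "complex ^ 'n::finite ^ 'n \<Rightarrow> complex"
  shows "\<lbrakk>f \<in> carrier CU; s \<in> unitary_group\<rbrakk> \<Longrightarrow> cmod (f s) \<le> cnorm CU f"
  by (metis CU_cnorm_attained)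

lemma CU_cnorm_eqI:
  assumes "s \<in> unitary_group" "\<And>s'. s' \<in> unitary_group \<Longrightarrow> cmod (f s') \<le> cmod (f s)"
  shows "cnorm CU f = cmod (f s)"
  unfolding CU_cnorm using assms by (intro cSup_eq_maximum) auto

section \<open>The C*-algebra structure on continuous functions\<close>

lemma ring_CU: "ring (CU :: (complex ^ 'n::finite ^ 'n \<Rightarrow> complex) cstar)"
proof (intro ringI abelian_groupI monoidI)
  fix f :: "complex ^ 'n ^ 'n \<Rightarrow> complex" assume "f \<in> carrier CU"
  then show "\<exists>g\<in>carrier CU. g \<oplus>\<^bsub>CU\<^esub> f = \<zero>\<^bsub>CU\<^esub>"
    by (intro bexI[of _ "\<lambda>s\<in>unitary_group. - f s"])
       (auto simp: CU_simps intro!: continuous_intros restrict_ext)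
qed (auto simp: CU_simps algebra_simps extensional_restrict intro!: continuous_intros
    cong: restrict_cong)

text \<open>Subtraction is defined through the abstract additive inverse, so its pointwise form
  comes from uniqueness of inverses. It is needed to evaluate \<open>cdist\<close>.\<close>

lemma CU_minus:
  fixes f g :: "complex ^ 'n::finite ^ 'n \<Rightarrow> complex"
  assumes "f \<in> carrier CU" "g \<in> carrier CU"
  shows "f \<ominus>\<^bsub>CU\<^esub> g = (\<lambda>s\<in>unitary_group. f s - g s)"
proof -
  interpret ring "CU :: (complex ^ 'n ^ 'n \<Rightarrow> complex) cstar" by (rule ring_CU)
  have "\<ominus>\<^bsub>CU\<^esub> g = (\<lambda>s\<in>unitary_group. - g s)"
    using assms
    by (intro minus_equality) (auto simp: CU_simps intro!: continuous_intros restrict_ext)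
  then show ?thesis
    by (auto simp: a_minus_def CU_simps intro!: restrict_ext)
qed

lemma CU_minus_closed:
  fixes f g :: "complex ^ 'n::finite ^ 'n \<Rightarrow> complex"
  shows "\<lbrakk>f \<in> carrier CU; g \<in> carrier CU\<rbrakk> \<Longrightarrow> (\<lambda>s\<in>unitary_group. f s - g s) \<in> carrier CU"
  by (auto simp: CU_simps intro!: continuous_intros)

text \<open>The supremum is attained, so a bound at every point bounds the distance. The metric laws
  and completeness are all reduced to pointwise estimates through this equivalence.\<close>

lemma CU_cdist_le_iff:
  fixes f g :: "complex ^ 'n::finite ^ 'n \<Rightarrow> complex"
  assumes "f \<in> carrier CU" "g \<in> carrier CU"
  shows "cdist CU f g \<le> e \<longleftrightarrow> (\<forall>s\<in>unitary_group. dist (f s) (g s) \<le> e)"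
proof -
  let ?d = "\<lambda>s\<in>unitary_group. f s - g s"
  obtain s where s: "s \<in> unitary_group" "cnorm CU ?d = cmod (?d s)"
    using CU_cnorm_attained[OF CU_minus_closed[OF assms]] by metis
  show ?thesis
  proof
    assume "cdist CU f g \<le> e"
    then show "\<forall>s\<in>unitary_group. dist (f s) (g s) \<le> e"
      using cmod_le_CU_cnorm[OF CU_minus_closed[OF assms]] assms
      by (force simp: cdist_def CU_minus dist_norm)
  next
    assume "\<forall>s\<in>unitary_group. dist (f s) (g s) \<le> e"
    then show "cdist CU f g \<le> e"
      using s assms by (simp add: cdist_def CU_minus dist_norm)
  qed
qed

lemma CU_cdist_nonneg:
  fixes f g :: "complex ^ 'n::finite ^ 'n \<Rightarrow> complex"
  shows "0 \<le> cdist CU f g"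
proof (cases "f \<in> carrier CU \<and> g \<in> carrier CU")
  case True
  \<comment> \<open>The identity matrix is chosen as a convenient point of the group.\<close>
  then have "dist (f (mat 1)) (g (mat 1)) \<le> cdist CU f g"
    using CU_cdist_le_iff one_unitary by blast
  then show ?thesis using zero_le_dist order_trans by blast
qed (auto simp: cdist_def)

lemma Metric_space_CU:
  "Metric_space (carrier CU) (cdist (CU :: (complex ^ 'n::finite ^ 'n \<Rightarrow> complex) cstar))"
proof
  fix f g h :: "complex ^ 'n ^ 'n \<Rightarrow> complex"
  show "0 \<le> cdist CU f g" by (rule CU_cdist_nonneg)
  show "cdist CU f g = cdist CU g f"
  proof (cases "f \<in> carrier CU \<and> g \<in> carrier CU")
    case True
    then have "cdist CU f g \<le> cdist CU g f" "cdist CU g f \<le> cdist CU f g"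
      using CU_cdist_le_iff dist_commute by (metis order_refl)+
    then show ?thesis by simp
  qed (auto simp: cdist_def)
  assume f: "f \<in> carrier CU" and g: "g \<in> carrier CU"
  \<comment> \<open>The bound 0 in \<open>CU_cdist_le_iff\<close> says that the functions agree at
    every point of the group.\<close>
  have "cdist CU f g \<le> 0 \<longleftrightarrow> f = g"
    using f g by (auto simp: CU_cdist_le_iff intro: CU_eqI)
  then show "cdist CU f g = 0 \<longleftrightarrow> f = g"
    using CU_cdist_nonneg[of f g] by auto
  assume h: "h \<in> carrier CU"
  have "dist (f s) (h s) \<le> cdist CU f g + cdist CU g h" if "s \<in> unitary_group" for s
  proof -
    have "dist (f s) (g s) \<le> cdist CU f g" "dist (g s) (h s) \<le> cdist CU g h"
      using CU_cdist_le_iff f g h that by blast+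
    then show ?thesis using dist_triangle[of "f s" "h s" "g s"] by linarith
  qed
  then show "cdist CU f h \<le> cdist CU f g + cdist CU g h"
    using f h by (simp add: CU_cdist_le_iff)
qed

text \<open>A Cauchy sequence for \<open>cdist\<close> is uniformly Cauchy on the group, and a
  uniform limit of continuous functions is continuous.\<close>

lemma mcomplete_CU:
  "Metric_space.mcomplete (carrier CU) (cdist (CU :: (complex ^ 'n::finite ^ 'n \<Rightarrow> complex) cstar))"
proof -
  interpret Metric_space "carrier CU" "cdist (CU :: (complex ^ 'n ^ 'n \<Rightarrow> complex) cstar)"
    by (rule Metric_space_CU)
  show ?thesis
    unfolding mcomplete_def
  proof (intro allI impI)
    fix F :: "nat \<Rightarrow> complex ^ 'n ^ 'n \<Rightarrow> complex"
    assume F: "MCauchy F"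
    then have c: "F n \<in> carrier CU" for n by (auto simp: MCauchy_def)
    have "uniformly_Cauchy_on unitary_group F"
      unfolding uniformly_Cauchy_on_def
    proof (intro allI impI)
      fix e :: real assume "0 < e"
      then obtain N where N: "\<And>m n. \<lbrakk>N \<le> m; N \<le> n\<rbrakk> \<Longrightarrow> cdist CU (F m) (F n) < e"
        using F unfolding MCauchy_def by meson
      have "dist (F m s) (F n s) < e" if "s \<in> unitary_group" "N \<le> m" "N \<le> n" for m n s
        using CU_cdist_le_iff[OF c c, of m n "cdist CU (F m) (F n)"] N[OF that(2,3)] that(1)
        by fastforce
      then show "\<exists>M. \<forall>s\<in>unitary_group. \<forall>m\<ge>M. \<forall>n\<ge>M. dist (F m s) (F n s) < e" by blast
    qed
    then obtain l where l: "uniform_limit unitary_group F l sequentially"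
      using Cauchy_uniformly_convergent uniformly_convergent_on_def by blast
    \<comment> \<open>The uniform limit \<open>l\<close> is arbitrary off the group; the restriction
      is extensional and so can lie in the carrier.\<close>
    define f where "f = restrict l unitary_group"
    have "continuous_on unitary_group l"
      using c by (intro uniform_limit_theorem[OF _ l]) (auto simp: CU_simps)
    then have f: "f \<in> carrier CU" by (simp add: CU_simps f_def)
    have "limitin mtopology F f sequentially"
      unfolding limit_metric_sequentially
    proof (intro conjI allI impI f)
      fix e :: real assume "0 < e"
      \<comment> \<open>Half of \<open>e\<close> is used because the pointwise estimates give only a
        non-strict bound on the distance.\<close>
      then obtain N where "\<And>n s. \<lbrakk>N \<le> n; s \<in> unitary_group\<rbrakk> \<Longrightarrow> dist (F n s) (l s) < e / 2"
        using l unfolding uniform_limit_sequentially_iff by (meson half_gt_zero)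
      then have "cdist CU (F n) f \<le> e / 2" if "N \<le> n" for n
        using that by (subst CU_cdist_le_iff[OF c f]) (simp add: f_def less_imp_le)
      then have "F n \<in> carrier CU \<and> cdist CU (F n) f < e" if "N \<le> n" for n
        using c \<open>0 < e\<close> that by fastforce
      then show "\<exists>N. \<forall>n\<ge>N. F n \<in> carrier CU \<and> cdist CU (F n) f < e" by blast
    qed
    then show "\<exists>f. limitin mtopology F f sequentially" by blast
  qed
qed

lemma unital_cstar_algebra_CU:
  "unital_cstar_algebra (CU :: (complex ^ 'n::finite ^ 'n \<Rightarrow> complex) cstar)"
proof (intro unital_cstar_algebra.intro unital_cstar_algebra_axioms.intro ring_CU mcomplete_CU)
  fix f g :: "complex ^ 'n ^ 'n \<Rightarrow> complex" and c :: complex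
  assume f: "f \<in> carrier CU"
  obtain s where s: "s \<in> unitary_group" "cnorm CU f = cmod (f s)"
    "\<And>s'. s' \<in> unitary_group \<Longrightarrow> cmod (f s') \<le> cmod (f s)"
    using CU_cnorm_attained[OF f] by metis
  show "0 \<le> cnorm CU f" by (simp add: s(2))
  show "cnorm CU f = 0 \<longleftrightarrow> f = \<zero>\<^bsub>CU\<^esub>"
  proof
    assume "cnorm CU f = 0"
    with s show "f = \<zero>\<^bsub>CU\<^esub>"
      using f by (intro CU_eqI) (auto simp: CU_simps)
  qed (use s in \<open>simp add: CU_simps\<close>)
  \<comment> \<open>Multiplying \<open>f\<close> by \<open>c\<close> or by \<open>star CU f\<close>
    keeps \<open>s\<close> a maximiser of the modulus, so homogeneity and the C*-identity become
    equalities at the single point \<open>s\<close>.\<close>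
  have "cnorm CU (scale CU c f) = cmod (scale CU c f s)"
    using s by (intro CU_cnorm_eqI) (auto simp: CU_simps norm_mult intro: mult_left_mono)
  then show "cnorm CU (scale CU c f) = cmod c * cnorm CU f"
    using s by (simp add: CU_simps norm_mult)
  have "cnorm CU (star CU f \<otimes>\<^bsub>CU\<^esub> f) = cmod ((star CU f \<otimes>\<^bsub>CU\<^esub> f) s)"
    using s by (intro CU_cnorm_eqI) (auto simp: CU_simps norm_mult intro: mult_mono)
  then show "cnorm CU (star CU f \<otimes>\<^bsub>CU\<^esub> f) = (cnorm CU f)\<^sup>2"
    using s by (simp add: CU_simps norm_mult power2_eq_square)
  assume g: "g \<in> carrier CU"
  have b: "cmod (f s) \<le> cnorm CU f" "cmod (g s) \<le> cnorm CU g" if "s \<in> unitary_group" for s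
    using cmod_le_CU_cnorm f g that by auto
  have "f \<oplus>\<^bsub>CU\<^esub> g \<in> carrier CU" "f \<otimes>\<^bsub>CU\<^esub> g \<in> carrier CU"
    using f g by (auto simp: CU_simps intro!: continuous_intros)
  \<comment> \<open>The sum and the product may attain their norms at points other than
    \<open>s\<close>; there the values of \<open>f\<close> and \<open>g\<close> are bounded by their
    norms.\<close>
  then obtain a m where a: "a \<in> unitary_group" "cnorm CU (f \<oplus>\<^bsub>CU\<^esub> g) = cmod ((f \<oplus>\<^bsub>CU\<^esub> g) a)"
    and m: "m \<in> unitary_group" "cnorm CU (f \<otimes>\<^bsub>CU\<^esub> g) = cmod ((f \<otimes>\<^bsub>CU\<^esub> g) m)"
    by (metis CU_cnorm_attained)
  show "cnorm CU (f \<oplus>\<^bsub>CU\<^esub> g) \<le> cnorm CU f + cnorm CU g"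
    unfolding a(2) using a(1) b[OF a(1)] norm_triangle_ineq[of "f a" "g a"] by (simp add: CU_simps)
  show "cnorm CU (f \<otimes>\<^bsub>CU\<^esub> g) \<le> cnorm CU f * cnorm CU g"
    unfolding m(2) using m(1) b[OF m(1)]
    by (simp add: CU_simps norm_mult) (meson mult_mono norm_ge_zero order_trans)
qed (auto simp: CU_simps algebra_simps extensional_restrict intro!: continuous_intros
    cong: restrict_cong)

section \<open>Composition with inner automorphisms, and the coordinate matrix\<close>

lemma psi_star_hom:
  fixes t :: "complex ^ 'n::finite ^ 'n"
  assumes t: "t \<in> unitary_group"
  shows "psi t \<in> star_hom CU CU"
proof -
  \<comment> \<open>The operations of \<open>CU\<close> are pointwise, so the algebraic laws are
    immediate once \<open>inner_aut t\<close> is known to be a continuous map of the group into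
    itself.\<close>
  have "continuous_on unitary_group (\<lambda>s. f (inner_aut t s))"
    if "continuous_on unitary_group f" for f :: "complex ^ 'n ^ 'n \<Rightarrow> complex"
    by (rule continuous_on_compose2[OF that])
       (auto simp: inner_aut_unitary[OF _ t], auto simp: inner_aut_def intro!: continuous_intros)
  then show ?thesis
    using inner_aut_unitary[OF _ t]
    by (auto simp: psi_def star_hom_def ring_hom_def CU_simps intro!: continuous_intros
        cong: restrict_cong)
qed

lemma CU_finsum:
  fixes f :: "'k \<Rightarrow> complex ^ 'n::finite ^ 'n \<Rightarrow> complex"
  assumes "finite S" "f \<in> S \<rightarrow> carrier CU"
  shows "finsum CU f S = (\<lambda>s\<in>unitary_group. \<Sum>k\<in>S. f k s)"
proof -
  interpret ring "CU :: (complex ^ 'n ^ 'n \<Rightarrow> complex) cstar" by (rule ring_CU)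
  show ?thesis using assms
  proof (induction S rule: finite_induct)
    case (insert k S)
    then show ?case by (subst finsum_insert) (auto simp: CU_simps cong: restrict_cong)
  qed (simp add: CU_simps)
qed

lemma coord_fun_closed: "coord_fun i j \<in> carrier CU"
  by (auto simp: coord_fun_def CU_simps intro!: continuous_intros)

text \<open>A matrix over \<open>CU\<close> is a continuous matrix-valued function on the group, and
  products, stars and the identity are computed at each point.\<close>

lemma mat_unitary_CU_iff:
  fixes x :: "'n::finite \<Rightarrow> 'n \<Rightarrow> complex ^ 'n ^ 'n \<Rightarrow> complex"
  assumes x: "\<And>i j. x i j \<in> carrier CU"
  shows "mat_unitary CU x \<longleftrightarrow> (\<forall>s\<in>unitary_group. (\<chi> i j. x i j s) \<in> unitary_group)"
proof -
  interpret unital_cstar_algebra "CU :: (complex ^ 'n ^ 'n \<Rightarrow> complex) cstar"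
    by (rule unital_cstar_algebra_CU)
  have "mat_mult CU y z = mat_one CU \<longleftrightarrow>
      (\<forall>s\<in>unitary_group. (\<chi> i j. y i j s) ** (\<chi> i j. z i j s) = mat 1)"
    if "\<And>i j. y i j \<in> carrier CU" "\<And>i j. z i j \<in> carrier CU"
    for y z :: "'n \<Rightarrow> 'n \<Rightarrow> complex ^ 'n ^ 'n \<Rightarrow> complex"
  proof -
    have mult: "mat_mult CU y z = (\<lambda>i j. \<lambda>s\<in>unitary_group. ((\<chi> i j. y i j s) ** (\<chi> i j. z i j s)) $ i $ j)"
      using that m_closed[unfolded CU_simps(2)]
      by (intro ext[where 'a = 'n])
         (auto simp: mat_mult_def CU_finsum CU_simps(2) matrix_matrix_mult_def cong: restrict_cong)
    have one: "mat_one CU = (\<lambda>(i :: 'n) j. \<lambda>s\<in>unitary_group. mat 1 $ i $ j)"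
      by (intro ext[where 'a = 'n]) (simp add: mat_one_def CU_simps mat_def)
    show ?thesis
      unfolding mult one by (auto simp: fun_eq_iff vec_eq_iff restrict_def)
  qed
  note m = this
  have star: "adjoint_mat (\<chi> i j. x i j s) = (\<chi> i j. mat_star CU x i j s)" if "s \<in> unitary_group" for s
    using that by (simp add: adjoint_mat_def mat_star_def CU_simps vec_eq_iff)
  have "(\<chi> i j. x i j s) \<in> unitary_group \<longleftrightarrow>
      (\<chi> i j. mat_star CU x i j s) ** (\<chi> i j. x i j s) = mat 1 \<and>
      (\<chi> i j. x i j s) ** (\<chi> i j. mat_star CU x i j s) = mat 1"
    if "s \<in> unitary_group" for s
    using star[OF that] by (simp add: unitary_group_def)
  moreover have "mat_star CU x i j \<in> carrier CU" for i j
    using x by (simp add: mat_star_def star_closed)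
  ultimately show ?thesis
    unfolding mat_unitary_def using x by (auto simp: m)
qed

text \<open>At a point \<open>s\<close> the coordinate matrix takes the value \<open>s\<close> and
  its entrywise conjugate the value \<open>conj_mat s\<close>, both unitary.\<close>

lemma biunitary_coord_fun:
  "biunitary (CU :: (complex ^ 'n::finite ^ 'n \<Rightarrow> complex) cstar) coord_fun"
proof -
  interpret unital_cstar_algebra "CU :: (complex ^ 'n ^ 'n \<Rightarrow> complex) cstar"
    by (rule unital_cstar_algebra_CU)
  have "mat_conj CU coord_fun i j \<in> carrier CU" for i j :: 'n
    by (simp add: mat_conj_def star_closed coord_fun_closed)
  moreover have "(\<chi> i j. coord_fun i j s) = s" if "s \<in> unitary_group" for s :: "complex ^ 'n ^ 'n"
    using that by (simp add: coord_fun_def vec_eq_iff)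
  moreover have "(\<chi> i j. mat_conj CU coord_fun i j s) = conj_mat s"
    if "s \<in> unitary_group" for s :: "complex ^ 'n ^ 'n"
    using that by (simp add: coord_fun_def vec_eq_iff conj_mat_def mat_conj_def CU_simps)
  ultimately show ?thesis
    by (simp add: biunitary_def mat_unitary_CU_iff coord_fun_closed conj_mat_unitary)
qed

text \<open>At a point \<open>s\<close> both sides are the \<open>(i, j)\<close> entry of
  \<open>t ** s ** adjoint_mat t\<close>.\<close>

lemma psi_coord_fun:
  fixes t :: "complex ^ 'n::finite ^ 'n"
  assumes "t \<in> unitary_group"
  shows "psi t (coord_fun i j) = unital_cstar_algebra.conjugate_by CU t coord_fun i j"
proof -
  interpret unital_cstar_algebra "CU :: (complex ^ 'n ^ 'n \<Rightarrow> complex) cstar"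
    by (rule unital_cstar_algebra_CU)
  have sc: "mat_scalar (CU :: (complex ^ 'n ^ 'n \<Rightarrow> complex) cstar) r k l \<in> carrier CU" for r :: "complex ^ 'n ^ 'n" and k l
    using mat_scalar_closed[of r] by auto
  have mc: "mat_mult CU (mat_scalar CU r) coord_fun k l \<in> carrier CU" for r :: "complex ^ 'n ^ 'n" and k l
    using mat_mult_closed[of "mat_scalar CU r" coord_fun] sc coord_fun_closed by auto
  have c: "mat_scalar CU r k l \<otimes>\<^bsub>CU\<^esub> coord_fun l m \<in> carrier CU"
    "mat_mult CU (mat_scalar CU r) coord_fun k l \<otimes>\<^bsub>CU\<^esub> mat_scalar CU r' l m \<in> carrier CU"
    for r r' :: "complex ^ 'n ^ 'n" and k l m
    by (intro m_closed mc sc coord_fun_closed)+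
  show ?thesis
    using assms inner_aut_unitary[OF _ assms] coord_fun_closed[of i j] c
    by (simp add: conjugate_by_def psi_def mat_mult_def CU_finsum)
       (simp add: CU_simps mat_scalar_def coord_fun_def inner_aut_def matrix_matrix_mult_def
          cong: restrict_cong)
qed

section \<open>Comparison of the two composites by universality\<close>

theorem theorem5p4:
  fixes A :: "'a cstar" and u :: "'n::finite \<Rightarrow> 'n \<Rightarrow> 'a" and t :: "complex ^ 'n ^ 'n"
  assumes "is_Au A u" and "t \<in> unitary_group"
  shows "compose (carrier A) (rho A u) (phi A u t) = compose (carrier A) (psi t) (rho A u)"
proof -
  interpret A: unital_cstar_algebra A using assms(1) by (simp add: is_Au_def)
  note A = A.unital_cstar_algebra_axioms
  have CU: "unital_cstar_algebra (CU :: (complex ^ 'n ^ 'n \<Rightarrow> complex) cstar)"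
    by (rule unital_cstar_algebra_CU)
  interpret CU: unital_cstar_algebra "CU :: (complex ^ 'n ^ 'n \<Rightarrow> complex) cstar" by (rule CU)
  have u: "biunitary A u" and u_closed: "\<And>i j. u i j \<in> carrier A"
    using assms(1) by (auto simp: is_Au_def biunitary_def mat_unitary_def)
  have univ_A: "\<exists>!h. h \<in> star_hom A A \<and> (\<forall>i j. h (u i j) = v i j)" if "biunitary A v" for v
    using assms(1) that A by (simp add: is_Au_def universal_for_def)
  have univ_CU: "\<exists>!h. h \<in> star_hom A CU \<and> (\<forall>i j. h (u i j) = v i j)"
    if "biunitary CU v" for v :: "'n \<Rightarrow> 'n \<Rightarrow> complex ^ 'n ^ 'n \<Rightarrow> complex"
    using assms(1) that CU by (simp add: is_Au_def universal_for_def)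

  \<comment> \<open>Universality applied to the biunitary coordinate matrix ensures that the
    definite description in \<open>rho\<close> denotes.\<close>
  have rho: "rho A u \<in> star_hom A CU" "\<And>i j. rho A u (u i j) = coord_fun i j"
    using theI'[OF univ_CU[OF biunitary_coord_fun]] by (simp_all add: rho_def)

  have hom_id: "(\<lambda>x\<in>carrier A. x) \<in> star_hom A A"
    by (auto simp: star_hom_def ring_hom_def A.scale_closed A.star_closed)
  \<comment> \<open>The composite and the identity agree on the entries of \<open>u\<close>, so they
    coincide by uniqueness. A general \<open>s\<close> allows the use with both \<open>t\<close> and
    \<open>adjoint_mat t\<close>.\<close>
  have inverse: "g (h x) = x"
    if s: "s \<in> unitary_group"
      and h: "h \<in> star_hom A A" "\<And>i j. h (u i j) = A.conjugate_by s u i j"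
      and g: "g \<in> star_hom A A" "\<And>i j. g (u i j) = A.conjugate_by (adjoint_mat s) u i j"
      and x: "x \<in> carrier A" for s g h x
  proof -
    have "compose (carrier A) g h (u i j) = u i j" for i j
    proof -
      have "compose (carrier A) g h (u i j) = g (A.conjugate_by s u i j)"
        by (simp add: compose_eq u_closed h(2))
      \<comment> \<open>Since \<open>g\<close> fixes the scalar factors and acts only on
        \<open>u\<close>, the conjugation coming from \<open>h\<close> stays outermost and cancels
        the inner one.\<close>
      also have "\<dots> = A.conjugate_by s (A.conjugate_by (adjoint_mat s) u) i j"
        by (simp add: star_hom_conjugate_by[OF g(1) A A] u_closed g(2))
      also have "\<dots> = u i j"
        using s u_closed by (simp add: A.conjugate_by_adjoint)
      finally show ?thesis .
    qed
    then have "compose (carrier A) g h = (\<lambda>x\<in>carrier A. x)"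
      using univ_A[OF u] star_hom_compose[OF h(1) g(1) A] hom_id u_closed
      by (metis restrict_apply')
    then show ?thesis using x by (metis compose_eq restrict_apply')
  qed

  obtain h where h: "h \<in> star_hom A A" "\<And>i j. h (u i j) = A.conjugate_by t u i j"
    using univ_A[OF A.biunitary_conjugate_by[OF assms(2) u]] by metis
  obtain g where g: "g \<in> star_hom A A" "\<And>i j. g (u i j) = A.conjugate_by (adjoint_mat t) u i j"
    using univ_A[OF A.biunitary_conjugate_by[OF adjoint_mat_unitary[OF assms(2)] u]] by metis
  \<comment> \<open>Two instances of \<open>inverse\<close> make \<open>g\<close> and
    \<open>h\<close> mutually inverse; the second exchanges their roles and takes
    \<open>adjoint_mat t\<close> for \<open>s\<close>.\<close>
  have "bij_betw h (carrier A) (carrier A)"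
    using h(1) g(1) inverse[OF assms(2) h g] inverse[OF adjoint_mat_unitary[OF assms(2)] g] h(2)
    by (intro bij_betwI[where g = g]) (auto simp: star_hom_def ring_hom_def h)
  \<comment> \<open>Uniqueness among all homomorphisms implies uniqueness among automorphisms, so
    the definite description in \<open>phi\<close> denotes \<open>h\<close>.\<close>
  then have "phi A u t = h"
    unfolding phi_def A.conjugate_by_def[symmetric]
    using h univ_A[OF A.biunitary_conjugate_by[OF assms(2) u]]
    by (intro the_equality) (auto simp: star_auto_def fun_eq_iff)
  note phi = h[folded this]

  have "compose (carrier A) (rho A u) (phi A u t) (u i j) = psi t (coord_fun i j)" for i j
    by (simp add: compose_eq u_closed phi(2) star_hom_conjugate_by[OF rho(1) A CU] rho(2)
        psi_coord_fun[OF assms(2)])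
  moreover have "compose (carrier A) (psi t) (rho A u) (u i j) = psi t (coord_fun i j)" for i j
    by (simp add: compose_eq u_closed rho(2))
  \<comment> \<open>Both composites lie in \<open>star_hom A CU\<close> and send \<open>u\<close> to
    the conjugate by \<open>t\<close> of the coordinate matrix. This conjugate is biunitary, so
    uniqueness in the universal property gives equality.\<close>
  ultimately show ?thesis
    using univ_CU[OF CU.biunitary_conjugate_by[OF assms(2) biunitary_coord_fun]]
      star_hom_compose[OF phi(1) rho(1) A] star_hom_compose[OF rho(1) psi_star_hom[OF assms(2)] A]
      psi_coord_fun[OF assms(2)] by metis
qed

end
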